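(* Fix $L>0$. There exist constants $C_1(b)>0$, for $b\in\mathbb{C}$ with $\operatorname{Im}b>0$, and $C_2(a,b)\geq 0$, for $a,b\in\mathbb{C}$ with $\operatorname{Im}a,\operatorname{Im}b>0$ and $|a-b|\leq\frac{|b|}{2}$, where $C_1(b)$ depends only on $b$ and $L$, and $C_2(a,b)$ depends only on $a$, $b$ and $L$ (in particular neither depends on $f$), such that for each fixed $b$ one has $C_2(a,b)\to 0$ as $a\to b$, and such that the following holds. For all $f\in PW_L$ and all $a,b\in\mathbb{C}$ with $\operatorname{Im}a,\operatorname{Im}b>0$ and $|a-b|\leq\frac{|b|}{2}$, setting $\beta_a=\frac{2\operatorname{Im}a}{|a|^2}$ and $\beta_b=\frac{2\operatorname{Im}b}{|b|^2}$, $$\inf_{|c|=1}\|\mathfrak{F}_af-c\,\mathfrak{F}_bf\|_2^2\leq C_1(b)\,\omega_2\big(\widehat f;|\beta_b-\beta_a|\big)\,\|f\|_2+C_2(a,b)\,\|f\|_2^2,$$ where the infimum is over all $c\in\mathbb{C}$ with $|c|=1$.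
   Context: $\|\cdot\|_2$ is the norm of $L^2(\mathbb{R})$ (complex-valued functions). The Fourier transform is normalized by $\widehat f(w)=\frac{1}{\sqrt{2\pi}}\int_{\mathbb{R}}f(x)e^{-iwx}\,dx$, extended unitarily to $L^2(\mathbb{R})$. For $L>0$, $PW_L$ (Paley-Wiener class) is the space of $f\in L^2(\mathbb{R})$ with $\operatorname{supp}\widehat f\subseteq[-L,L]$. For $a\in\mathbb{C}$ with $\operatorname{Im}a>0$, the flipping operator is $$(\mathfrak{F}_af)(x)=\frac{1-x/\bar a}{1-x/a}\cdot\frac{e^{x/\bar a}}{e^{x/a}}\,f(x),\qquad x\in\mathbb{R}.$$ It is defined whether or not $f$ vanishes at $a$, and $|\mathfrak{F}_af|=|f|$ on $\mathbb{R}$. For $F\in L^2(\mathbb{R})$ and $h\geq 0$, the $L^2$-modulus of continuity is $$\omega_2(F;h)=\sup_{|\eta|\leq h}\left(\int_{\mathbb{R}}|F(x-\eta)-F(x)|^2\,dx\right)^{1/2}.$$ *)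

theory Defs
  imports "HOL-Analysis.Analysis"
begin

text \<open>
  Elements of \<open>L\<^sup>2(\<real>)\<close> are handled through Borel representatives (each Lebesgue class contains one);
  equality of classes is equality almost everywhere.
\<close>

definition L2_space :: "(real \<Rightarrow> complex) set" where
  "L2_space = {f. f \<in> borel_measurable lborel \<and> integrable lborel (\<lambda>x. (cmod (f x))\<^sup>2)}"

text \<open>
  Meaningful only on \<^const>\<open>L2_space\<close>: the Bochner integral of a non-integrable function is \<open>0\<close>.
\<close>

definition L2_norm :: "(real \<Rightarrow> complex) \<Rightarrow> real" where
  "L2_norm f = sqrt (\<integral>x. (cmod (f x))\<^sup>2 \<partial>lborel)"

definition tendsto_L2 :: "(nat \<Rightarrow> real \<Rightarrow> complex) \<Rightarrow> (real \<Rightarrow> complex) \<Rightarrow> bool" where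
  "tendsto_L2 g f \<longleftrightarrow> (\<forall>n. g n \<in> L2_space) \<and> f \<in> L2_space \<and>
     (\<lambda>n. L2_norm (\<lambda>x. g n x - f x)) \<longlonglongrightarrow> 0"

definition fourier_L1 :: "(real \<Rightarrow> complex) \<Rightarrow> real \<Rightarrow> complex" where
  "fourier_L1 f w =
     1 / complex_of_real (sqrt (2 * pi)) *
       (\<integral>x. f x * exp (- \<i> * complex_of_real w * complex_of_real x) \<partial>lborel)"

text \<open>
  The extension to \<open>L\<^sup>2\<close> by continuity from the dense subspace \<open>L\<^sup>1 \<inter> L\<^sup>2\<close>, as a relation: \<open>F\<close> is a
  representative of the transform of \<open>f\<close>.  By Plancherel's theorem every \<open>f\<close> in \<^const>\<open>L2_space\<close> has
  such an \<open>F\<close>, unique almost everywhere.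
\<close>

definition has_fourier_L2 :: "(real \<Rightarrow> complex) \<Rightarrow> (real \<Rightarrow> complex) \<Rightarrow> bool" where
  "has_fourier_L2 f F \<longleftrightarrow>
     (\<exists>g. (\<forall>n. integrable lborel (g n)) \<and> tendsto_L2 g f \<and> tendsto_L2 (\<lambda>n. fourier_L1 (g n)) F)"

text \<open>
  The support of a class of functions modulo null sets: the complement of the largest open set on
  which the function vanishes almost everywhere.
\<close>

definition ess_support :: "(real \<Rightarrow> complex) \<Rightarrow> real set" where
  "ess_support F = - \<Union>{U. open U \<and> (AE x in lborel. x \<in> U \<longrightarrow> F x = 0)}"

definition PW :: "real \<Rightarrow> (real \<Rightarrow> complex) set" where
  "PW L = {f \<in> L2_space. \<exists>F. has_fourier_L2 f F \<and> ess_support F \<subseteq> {-L..L}}"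

definition flip :: "complex \<Rightarrow> (real \<Rightarrow> complex) \<Rightarrow> real \<Rightarrow> complex" where
  "flip a f x =
     (1 - complex_of_real x / cnj a) / (1 - complex_of_real x / a) *
     (exp (complex_of_real x / cnj a) / exp (complex_of_real x / a)) * f x"

definition modulus_L2 :: "(real \<Rightarrow> complex) \<Rightarrow> real \<Rightarrow> real" where
  "modulus_L2 F h = (SUP \<eta>\<in>{\<eta>. \<bar>\<eta>\<bar> \<le> h}. L2_norm (\<lambda>x. F (x - \<eta>) - F x))"

end

theory Submission
  imports Defs "HOL-Probability.Characteristic_Functions"
begin

text \<open>
  Since \<open>1/cnj a - 1/a = \<i> \<beta>\<^sub>a\<close>, flipping multiplies \<open>f\<close> by \<open>e\<close> to the power \<open>\<i> \<beta>\<^sub>a x\<close> and by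
  \<open>a / cnj a\<close> times the Blaschke factor \<open>(cnj a - x) / (a - x)\<close>.  With \<open>c\<close> the quotient of the two
  constants for \<open>a\<close> and \<open>b\<close>, the Blaschke factors differ by at most \<open>4 |a - b| / Im a\<close> uniformly
  in \<open>x\<close>, while the difference of the exponentials becomes a translation difference of the Fourier
  transform.  This needs only the inequality \<open>\<parallel>g\<parallel> \<le> \<parallel>fourier g\<parallel>\<close> for \<open>g\<close> in \<open>L\<^sup>1 \<inter> L\<^sup>2\<close>, obtained by
  testing the autocorrelation of \<open>g\<close>, whose unnormalised transform is \<open>2 \<pi>\<close> times the squared
  modulus of the transform of \<open>g\<close>, against shrinking Gaussians.  As the norm of the exponential
  difference times \<open>f\<close> is also at most \<open>2 \<parallel>f\<parallel>\<close>, one factor of its square can be traded for \<open>\<parallel>f\<parallel>\<close>.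
\<close>

section \<open>Calculus of squared L2 norms\<close>

lemma cmod_diff_sq_le: "(cmod (u - v))\<^sup>2 \<le> 2 * (cmod u)\<^sup>2 + 2 * (cmod v)\<^sup>2"
proof -
  have "(cmod (u - v))\<^sup>2 \<le> (cmod u + cmod v)\<^sup>2"
    by (intro power_mono norm_triangle_ineq4) auto
  also have "\<dots> \<le> 2 * (cmod u)\<^sup>2 + 2 * (cmod v)\<^sup>2"
    using sum_squares_bound[of "cmod u" "cmod v"] by (simp add: power2_sum)
  finally show ?thesis .
qed

lemma L2_measurable: "f \<in> L2_space \<Longrightarrow> f \<in> borel_measurable borel"
  by (simp add: L2_space_def)

lemma L2_integrable: "f \<in> L2_space \<Longrightarrow> integrable lborel (\<lambda>x. (cmod (f x))\<^sup>2)"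
  by (simp add: L2_space_def)

lemma L2_norm_nonneg: "L2_norm f \<ge> 0"
  by (simp add: L2_norm_def)

lemma L2_norm_sq: "(L2_norm f)\<^sup>2 = (\<integral>x. (cmod (f x))\<^sup>2 \<partial>lborel)"
  by (simp add: L2_norm_def integral_nonneg_AE)

lemma L2_dominated:
  assumes "f \<in> L2_space" and [measurable]: "g \<in> borel_measurable borel"
    and le: "\<And>x. cmod (g x) \<le> K * cmod (f x)"
  shows "g \<in> L2_space" "(L2_norm g)\<^sup>2 \<le> K\<^sup>2 * (L2_norm f)\<^sup>2"
proof -
  have sq: "(cmod (g x))\<^sup>2 \<le> K\<^sup>2 * (cmod (f x))\<^sup>2" for x
    using power_mono[OF le[of x], of 2] by (simp add: power_mult_distrib)
  have int: "integrable lborel (\<lambda>x. K\<^sup>2 * (cmod (f x))\<^sup>2)"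
    using assms by (simp add: L2_space_def)
  have "integrable lborel (\<lambda>x. (cmod (g x))\<^sup>2)"
    by (rule Bochner_Integration.integrable_bound[OF int]) (use sq in \<open>auto intro: order_trans\<close>)
  then show "g \<in> L2_space" by (simp add: L2_space_def)
  show "(L2_norm g)\<^sup>2 \<le> K\<^sup>2 * (L2_norm f)\<^sup>2"
    unfolding L2_norm_sq integral_mult_right_zero[symmetric]
    by (intro integral_mono int sq) fact
qed

text \<open>Integrating \<open>cmod_diff_sq_le\<close> replaces Minkowski's inequality. The factors
  lost this way only enlarge the final constants, whose size the theorem leaves open.\<close>

lemma L2_diff:
  assumes "f \<in> L2_space" "g \<in> L2_space"
  shows "(\<lambda>x. f x - g x) \<in> L2_space"
    and "(L2_norm (\<lambda>x. f x - g x))\<^sup>2 \<le> 2 * (L2_norm f)\<^sup>2 + 2 * (L2_norm g)\<^sup>2"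
proof -
  have [measurable]: "f \<in> borel_measurable borel" "g \<in> borel_measurable borel"
    using assms by (auto simp: L2_space_def)
  have int: "integrable lborel (\<lambda>x. 2 * (cmod (f x))\<^sup>2 + 2 * (cmod (g x))\<^sup>2)"
    using assms by (simp add: L2_space_def)
  have "integrable lborel (\<lambda>x. (cmod (f x - g x))\<^sup>2)"
    by (rule Bochner_Integration.integrable_bound[OF int])
      (use cmod_diff_sq_le in \<open>auto intro: order_trans\<close>)
  then show "(\<lambda>x. f x - g x) \<in> L2_space" by (simp add: L2_space_def)
  have "(L2_norm (\<lambda>x. f x - g x))\<^sup>2 \<le> (\<integral>x. 2 * (cmod (f x))\<^sup>2 + 2 * (cmod (g x))\<^sup>2 \<partial>lborel)"
    unfolding L2_norm_sq by (intro integral_mono int cmod_diff_sq_le) fact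
  also have "\<dots> = 2 * (L2_norm f)\<^sup>2 + 2 * (L2_norm g)\<^sup>2"
    using assms by (simp add: L2_space_def L2_norm_sq)
  finally show "(L2_norm (\<lambda>x. f x - g x))\<^sup>2 \<le> 2 * (L2_norm f)\<^sup>2 + 2 * (L2_norm g)\<^sup>2" .
qed

lemma L2_norm_minus_commute: "L2_norm (\<lambda>x. f x - g x) = L2_norm (\<lambda>x. g x - f x)"
  by (simp add: L2_norm_def norm_minus_commute)

text \<open>Reads \<open>f\<close> as \<open>g - (g - f)\<close>: the form in which approximation
  errors are split off later.\<close>

lemma L2_norm_le_split:
  assumes "f \<in> L2_space" "g \<in> L2_space"
  shows "(L2_norm f)\<^sup>2 \<le> 2 * (L2_norm g)\<^sup>2 + 2 * (L2_norm (\<lambda>x. f x - g x))\<^sup>2"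
proof -
  have "(L2_norm (\<lambda>x. g x - (g x - f x)))\<^sup>2 \<le> 2 * (L2_norm g)\<^sup>2 + 2 * (L2_norm (\<lambda>x. g x - f x))\<^sup>2"
    by (intro L2_diff assms)
  then show ?thesis by (simp add: L2_norm_minus_commute[of f g])
qed

lemma L2_shift:
  assumes "f \<in> L2_space"
  shows "(\<lambda>x. f (x + t)) \<in> L2_space" "L2_norm (\<lambda>x. f (x + t)) = L2_norm f"
proof -
  have [measurable]: "f \<in> borel_measurable borel" using assms by (simp add: L2_measurable)
  have "integrable lborel (\<lambda>x. (cmod (f (t + 1 * x)))\<^sup>2)"
    using assms by (intro lborel_integrable_real_affine[where f="\<lambda>x. (cmod (f x))\<^sup>2"] L2_integrable) auto
  then show "(\<lambda>x. f (x + t)) \<in> L2_space"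
    by (simp add: L2_space_def add.commute)
  show "L2_norm (\<lambda>x. f (x + t)) = L2_norm f"
    unfolding L2_norm_def
    by (subst (2) lborel_integral_real_affine[of 1 _ t]) (auto simp: add.commute)
qed

section \<open>Approximation and continuity of translations in L2\<close>

lemma L2_norm_tendsto_0:
  fixes g :: "nat \<Rightarrow> real \<Rightarrow> complex"
  assumes "f \<in> L2_space" "\<And>n. g n \<in> borel_measurable borel"
    and "AE x in lborel. (\<lambda>n. g n x) \<longlonglongrightarrow> 0" "\<And>n x. cmod (g n x) \<le> cmod (f x)"
  shows "(\<lambda>n. (L2_norm (g n))\<^sup>2) \<longlonglongrightarrow> 0"
proof -
  have "(\<lambda>n. \<integral>x. (cmod (g n x))\<^sup>2 \<partial>lborel) \<longlonglongrightarrow> (\<integral>x. 0 \<partial>(lborel :: real measure))"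
  proof (rule integral_dominated_convergence[where w="\<lambda>x. (cmod (f x))\<^sup>2"])
    show "AE x in lborel. (\<lambda>n. (cmod (g n x))\<^sup>2) \<longlonglongrightarrow> 0"
      using assms(3)
    proof eventually_elim
      case (elim x)
      then have "(\<lambda>n. (cmod (g n x))\<^sup>2) \<longlonglongrightarrow> (cmod 0)\<^sup>2"
        by (intro tendsto_intros)
      then show ?case by simp
    qed
  qed (use assms in \<open>auto simp: L2_integrable L2_measurable power_mono\<close>)
  then show ?thesis by (simp add: L2_norm_sq)
qed

lemma L2_bounded_support:
  assumes [measurable]: "h \<in> borel_measurable borel"
    and "\<And>x. cmod (h x) \<le> M" "\<And>x. \<bar>x\<bar> > R \<Longrightarrow> h x = 0"
  shows "h \<in> L2_space"
proof -
  have "integrable lborel (\<lambda>x. M\<^sup>2 * indicator {-R..R} x :: real)"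
    by (intro integrable_mult_right integrable_real_indicator) (auto simp: emeasure_lborel_Icc_eq)
  then have "integrable lborel (\<lambda>x. (cmod (h x))\<^sup>2)"
  proof (rule Bochner_Integration.integrable_bound)
    show "AE x in lborel. norm ((cmod (h x))\<^sup>2) \<le> norm (M\<^sup>2 * indicator {-R..R} x :: real)"
      using assms(2,3) by (auto simp: indicator_def power_mono abs_le_iff not_le)
  qed simp
  then show ?thesis by (simp add: L2_space_def)
qed

text \<open>At each point the truncation error is 0 for all large levels, and it is dominated by
  \<open>f\<close>. One level \<open>N\<close> cuts both the argument and the value, since
  \<open>L2_approx_bounded\<close> takes a single bound for height and support.\<close>

lemma L2_truncate:
  assumes f: "f \<in> L2_space" and "e > 0"
  obtains N where "N > 0"
    "(L2_norm (\<lambda>x. f x - (if \<bar>x\<bar> \<le> N \<and> cmod (f x) \<le> N then f x else 0)))\<^sup>2 < e"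
proof -
  note [measurable] = L2_measurable[OF f]
  let ?g = "\<lambda>n x. f x - (if \<bar>x\<bar> \<le> real (Suc n) \<and> cmod (f x) \<le> real (Suc n) then f x else 0)"
  have "(\<lambda>n. (L2_norm (?g n))\<^sup>2) \<longlonglongrightarrow> 0"
  proof (rule L2_norm_tendsto_0[OF f])
    show "AE x in lborel. (\<lambda>n. ?g n x) \<longlonglongrightarrow> 0"
    proof (rule AE_I2, rule tendsto_eventually)
      fix x
      obtain n0 :: nat where "max \<bar>x\<bar> (cmod (f x)) \<le> real n0"
        using real_arch_simple by blast
      then show "eventually (\<lambda>n. ?g n x = 0) sequentially"
        by (intro eventually_sequentiallyI[of n0]) auto
    qed
  qed auto
  then have "eventually (\<lambda>n. (L2_norm (?g n))\<^sup>2 < e) sequentially"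
    using \<open>e > 0\<close> by (rule order_tendstoD)
  then obtain n where "(L2_norm (?g n))\<^sup>2 < e"
    by (auto simp: eventually_sequentially)
  then show thesis by (intro that[of "real (Suc n)"]) auto
qed

text \<open>A measurable function is an almost everywhere limit of continuous functions, by the
  definition of \<open>measurable_on\<close>. These come without any bound, so they are projected
  onto a disc and multiplied by a cut-off function. Both operations preserve continuity, and the
  resulting uniform bounds turn pointwise convergence into convergence in L2.\<close>

lemma L2_approx_bounded:
  fixes f :: "real \<Rightarrow> complex"
  assumes [measurable]: "f \<in> borel_measurable borel" and M: "M > 0" "\<And>x. cmod (f x) \<le> M"
    and supp: "\<And>x. \<bar>x\<bar> > M \<Longrightarrow> f x = 0" and "e > 0"
  obtains h where "continuous_on UNIV h" "\<And>x. cmod (h x) \<le> M" "\<And>x. \<bar>x\<bar> > M + 1 \<Longrightarrow> h x = 0"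
    "(L2_norm (\<lambda>x. f x - h x))\<^sup>2 < e"
proof -
  have "f \<in> borel_measurable lebesgue"
    using assms(1) by (simp add: measurable_completion)
  then have "f measurable_on UNIV"
    by (intro lebesgue_measurable_imp_measurable_on) auto
  then obtain N g where N: "negligible N" and g: "\<And>n. continuous_on UNIV (g n)"
    "\<And>x. x \<notin> N \<Longrightarrow> (\<lambda>n. g n x) \<longlonglongrightarrow> f x"
    unfolding measurable_on_def by auto
  \<comment> \<open>\<open>cut\<close> is 1 on [-M, M] and 0 outside [-M-1, M+1]. As
    \<open>f\<close> takes values in the disc and vanishes outside [-M, M], projecting and cutting
    leave it unchanged, so the limit is still \<open>f\<close>.\<close>
  define cut :: "real \<Rightarrow> real" where "cut x = max 0 (min 1 (M + 1 - \<bar>x\<bar>))" for x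
  define h where "h n x = cut x *\<^sub>R closest_point (cball 0 M) (g n x)" for n x
  have cp: "continuous_on UNIV (closest_point (cball (0::complex) M))"
    using M by (intro continuous_on_closest_point) auto
  have cont: "continuous_on UNIV (h n)" for n
    unfolding h_def cut_def
    by (intro continuous_intros continuous_on_compose2[OF cp g(1)]) auto
  have cle: "cmod (closest_point (cball 0 M) z) \<le> M" for z :: complex
    using closest_point_in_set[of "cball (0::complex) M" z] M by auto
  have cut: "0 \<le> cut x" "cut x \<le> 1" for x by (auto simp: cut_def)
  have hM: "cmod (h n x) \<le> M" for n x
    using mult_mono[OF cut(2)[of x] cle[of "g n x"]] cut[of x] M by (simp add: h_def)
  have hs: "h n x = 0" if "\<bar>x\<bar> > M + 1" for n x
    using that by (simp add: h_def cut_def)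
  have lim: "(\<lambda>n. f x - h n x) \<longlonglongrightarrow> 0" if "x \<notin> N" for x
  proof -
    have "(\<lambda>n. h n x) \<longlonglongrightarrow> cut x *\<^sub>R closest_point (cball 0 M) (f x)"
      unfolding h_def
      by (intro tendsto_intros continuous_on_tendsto_compose[OF cp g(2)[OF that]]) auto
    also have "cut x *\<^sub>R closest_point (cball 0 M) (f x) = f x"
      using M(2)[of x] supp[of x] by (cases "\<bar>x\<bar> > M") (auto simp: closest_point_self cut_def)
    finally show ?thesis by (auto intro: tendsto_eq_intros)
  qed
  have [measurable]: "h n \<in> borel_measurable borel" for n
    using cont by (rule borel_measurable_continuous_onI)
  have "(\<lambda>n. (L2_norm (\<lambda>x. f x - h n x))\<^sup>2) \<longlonglongrightarrow> 0"
  proof (rule L2_norm_tendsto_0)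
    show "(\<lambda>x. of_real (2 * M * indicator {-M-1..M+1} x)) \<in> L2_space"
      by (rule L2_bounded_support[of _ "2 * M" "M + 1"]) (use M in \<open>auto simp: indicator_def\<close>)
    have "AE x in lebesgue. x \<notin> N"
      using N by (simp add: negligible_iff_null_sets AE_not_in)
    then have "AE x in lborel. x \<notin> N" by (simp add: AE_completion_iff)
    then show "AE x in lborel. (\<lambda>n. f x - h n x) \<longlonglongrightarrow> 0"
      by eventually_elim (rule lim)
    show "cmod (f x - h n x) \<le> cmod (of_real (2 * M * indicator {-M-1..M+1} x))" for n x
    proof (cases "\<bar>x\<bar> \<le> M + 1")
      case True
      then show ?thesis
        using norm_triangle_ineq4[of "f x" "h n x"] hM[of n x] M(1) M(2)[of x] by (auto simp: indicator_def)
    next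
      case False
      then show ?thesis using supp[of x] hs[of x n] by auto
    qed
  qed auto
  then have "eventually (\<lambda>n. (L2_norm (\<lambda>x. f x - h n x))\<^sup>2 < e) sequentially"
    using \<open>e > 0\<close> by (rule order_tendstoD)
  then obtain n where "(L2_norm (\<lambda>x. f x - h n x))\<^sup>2 < e"
    by (auto simp: eventually_sequentially)
  with that[of "h n"] cont hM hs show thesis by auto
qed

text \<open>Continuity gives pointwise convergence. A bound \<open>B\<close> on the shifts confines
  all differences to [-R-B, R+B], which supplies the integrable majorant.\<close>

lemma L2_translation_continuous_compact_support:
  fixes h :: "real \<Rightarrow> complex"
  assumes cont: "continuous_on UNIV h" and hM: "\<And>x. cmod (h x) \<le> M"
    and supp: "\<And>x. \<bar>x\<bar> > R \<Longrightarrow> h x = 0" and t: "t \<longlonglongrightarrow> (0::real)"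
  shows "(\<lambda>n. (L2_norm (\<lambda>x. h (x + t n) - h x))\<^sup>2) \<longlonglongrightarrow> 0"
proof -
  obtain B where B: "B > 0" "\<And>n. \<bar>t n\<bar> \<le> B"
    using convergent_imp_Bseq[OF convergentI[OF t]] by (auto simp: Bseq_def)
  have M: "M \<ge> 0" using order_trans[OF norm_ge_zero hM] .
  have [measurable]: "h \<in> borel_measurable borel"
    using cont by (rule borel_measurable_continuous_onI)
  show ?thesis
  proof (rule L2_norm_tendsto_0)
    show "(\<lambda>x. of_real (2 * M * indicator {-R-B..R+B} x)) \<in> L2_space"
      by (rule L2_bounded_support[of _ "2 * M" "R + B"]) (use M in \<open>auto simp: indicator_def\<close>)
    show "AE x in lborel. (\<lambda>n. h (x + t n) - h x) \<longlonglongrightarrow> 0"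
    proof (rule AE_I2)
      fix x
      have "(\<lambda>n. x + t n) \<longlonglongrightarrow> x"
        using tendsto_add[OF tendsto_const t, of x] by simp
      then have "(\<lambda>n. h (x + t n)) \<longlonglongrightarrow> h x"
        by (intro continuous_on_tendsto_compose[OF cont]) auto
      then show "(\<lambda>n. h (x + t n) - h x) \<longlonglongrightarrow> 0"
        by (auto intro: tendsto_eq_intros)
    qed
    show "cmod (h (x + t n) - h x) \<le> cmod (of_real (2 * M * indicator {-R-B..R+B} x))" for n x
    proof (cases "\<bar>x\<bar> \<le> R + B")
      case True
      then show ?thesis
        using norm_triangle_ineq4[of "h (x + t n)" "h x"] hM[of x] hM[of "x + t n"] M by (auto simp: indicator_def)
    next
      case False
      then have "\<bar>x\<bar> > R" "\<bar>x + t n\<bar> > R" using B(1) B(2)[of n] by linarith+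
      then show ?thesis by (simp add: supp)
    qed
  qed auto
qed

text \<open>A density argument: translations are isometries, so the error \<open>d\<close> between
  \<open>f\<close> and a continuous compactly supported \<open>h\<close> contributes at most four
  times its squared norm, uniformly in the shift.\<close>

lemma L2_translation_continuous:
  assumes f: "f \<in> L2_space" and t: "t \<longlonglongrightarrow> (0::real)"
  shows "(\<lambda>n. (L2_norm (\<lambda>x. f (x + t n) - f x))\<^sup>2) \<longlonglongrightarrow> 0"
proof (rule LIMSEQ_I)
  fix e :: real assume "e > 0"
  note [measurable] = L2_measurable[OF f]
  \<comment> \<open>Two errors below e/40, from truncation and from smoothing, bound the squared
    norm of \<open>d\<close> by e/10. The final split then costs 2 * e/10 + 2 * 4 * e/10 =
    e.\<close>
  obtain N where N: "N > 0"
    "(L2_norm (\<lambda>x. f x - (if \<bar>x\<bar> \<le> N \<and> cmod (f x) \<le> N then f x else 0)))\<^sup>2 < e / 40"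
    using L2_truncate[OF f, of "e / 40"] \<open>e > 0\<close> by auto
  define g where "g x = (if \<bar>x\<bar> \<le> N \<and> cmod (f x) \<le> N then f x else 0)" for x
  have [measurable]: "g \<in> borel_measurable borel" unfolding g_def by measurable
  obtain h where h: "continuous_on UNIV h" "\<And>x. cmod (h x) \<le> N" "\<And>x. \<bar>x\<bar> > N + 1 \<Longrightarrow> h x = 0"
    "(L2_norm (\<lambda>x. g x - h x))\<^sup>2 < e / 40"
    by (rule L2_approx_bounded[of g N "e / 40"]) (use N(1) \<open>e > 0\<close> in \<open>auto simp: g_def\<close>)
  have hmeas: "h \<in> borel_measurable borel"
    using h(1) by (rule borel_measurable_continuous_onI)
  have hL: "h \<in> L2_space" by (rule L2_bounded_support[OF hmeas h(2,3)])
  have gL: "g \<in> L2_space"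
    by (rule L2_dominated[OF f, where K=1]) (auto simp: g_def)
  define d where "d x = f x - h x" for x
  have dL: "d \<in> L2_space" unfolding d_def by (intro L2_diff f hL)
  have "d = (\<lambda>x. (f x - g x) - (h x - g x))" by (auto simp: d_def)
  then have "(L2_norm d)\<^sup>2 \<le> 2 * (L2_norm (\<lambda>x. f x - g x))\<^sup>2 + 2 * (L2_norm (\<lambda>x. h x - g x))\<^sup>2"
    by (simp only:) (intro L2_diff f hL gL)
  then have d: "(L2_norm d)\<^sup>2 < e / 10"
    using N(2) h(4) by (simp add: g_def[symmetric] L2_norm_minus_commute[of h g])
  have "eventually (\<lambda>n. (L2_norm (\<lambda>x. h (x + t n) - h x))\<^sup>2 < e / 10) sequentially"
    using \<open>e > 0\<close>
    by (intro order_tendstoD(2)[OF L2_translation_continuous_compact_support[OF h(1,2,3) t]]) auto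
  then obtain n0 where n0: "\<And>n. n \<ge> n0 \<Longrightarrow> (L2_norm (\<lambda>x. h (x + t n) - h x))\<^sup>2 < e / 10"
    by (auto simp: eventually_sequentially)
  show "\<exists>no. \<forall>n\<ge>no. norm ((L2_norm (\<lambda>x. f (x + t n) - f x))\<^sup>2 - 0) < e"
  proof (intro exI allI impI)
    fix n assume "n \<ge> n0"
    have "(L2_norm (\<lambda>x. f (x + t n) - f x))\<^sup>2
      \<le> 2 * (L2_norm (\<lambda>x. h (x + t n) - h x))\<^sup>2
        + 2 * (L2_norm (\<lambda>x. (f (x + t n) - f x) - (h (x + t n) - h x)))\<^sup>2"
      by (intro L2_norm_le_split L2_diff L2_shift f hL)
    moreover have "(\<lambda>x. (f (x + t n) - f x) - (h (x + t n) - h x)) = (\<lambda>x. d (x + t n) - d x)"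
      by (auto simp: d_def)
    moreover have "(L2_norm (\<lambda>x. d (x + t n) - d x))\<^sup>2
      \<le> 2 * (L2_norm (\<lambda>x. d (x + t n)))\<^sup>2 + 2 * (L2_norm d)\<^sup>2"
      by (intro L2_diff L2_shift dL)
    ultimately show "norm ((L2_norm (\<lambda>x. f (x + t n) - f x))\<^sup>2 - 0) < e"
      using n0[OF \<open>n \<ge> n0\<close>] d L2_shift(2)[OF dL, of "t n"] \<open>e > 0\<close> by simp
  qed
qed

section \<open>The autocorrelation and its Fourier transform\<close>

text \<open>The convolution of \<open>g\<close> with the reflected conjugate x ->
  \<open>cnj (g (-x))\<close>. For \<open>g\<close> in L2 its value at 0 is the squared norm of
  \<open>g\<close>.\<close>

definition autocorr :: "(real \<Rightarrow> complex) \<Rightarrow> real \<Rightarrow> complex" where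
  "autocorr g t = (\<integral>x. g (x + t) * cnj (g x) \<partial>lborel)"

lemma cmod_diff_sq: "(cmod (u - v))\<^sup>2 = (cmod u)\<^sup>2 + (cmod v)\<^sup>2 - 2 * Re (u * cnj v)"
  by (simp only: cmod_power2) (simp add: power2_eq_square algebra_simps)

lemma borel_measurable_cnj [measurable (raw)]:
  "f \<in> borel_measurable M \<Longrightarrow> (\<lambda>x. cnj (f x)) \<in> borel_measurable M"
  by (rule borel_measurable_continuous_on[of cnj]) (auto intro: continuous_intros)

lemma integrable_mult_cnj_L2:
  assumes "f \<in> L2_space" "g \<in> L2_space"
  shows "integrable lborel (\<lambda>x. f x * cnj (g x))"
proof (rule Bochner_Integration.integrable_bound)
  show "integrable lborel (\<lambda>x. (cmod (f x))\<^sup>2 + (cmod (g x))\<^sup>2)"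
    using assms by (simp add: L2_integrable)
  have "cmod (f x) * cmod (g x) \<le> (cmod (f x))\<^sup>2 + (cmod (g x))\<^sup>2" for x
    using sum_squares_bound[of "cmod (f x)" "cmod (g x)"]
      mult_nonneg_nonneg[OF norm_ge_zero[of "f x"] norm_ge_zero[of "g x"]] by linarith
  then show "AE x in lborel. norm (f x * cnj (g x)) \<le> norm ((cmod (f x))\<^sup>2 + (cmod (g x))\<^sup>2)"
    by (simp add: norm_mult)
qed (use assms[THEN L2_measurable] in measurable)

text \<open>The polarisation identity, integrated for \<open>g\<close> and its translate, which have
  equal norms. It reduces continuity of the autocorrelation at 0 to continuity of
  translations.\<close>

lemma Re_autocorr:
  assumes "g \<in> L2_space"
  shows "Re (autocorr g t) = (L2_norm g)\<^sup>2 - (L2_norm (\<lambda>x. g (x + t) - g x))\<^sup>2 / 2"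
proof -
  note i = integrable_mult_cnj_L2[OF L2_shift(1)[OF assms, of t] assms]
  have "(L2_norm (\<lambda>x. g (x + t) - g x))\<^sup>2
    = (\<integral>x. (cmod (g (x + t)))\<^sup>2 + (cmod (g x))\<^sup>2 - 2 * Re (g (x + t) * cnj (g x)) \<partial>lborel)"
    by (simp only: L2_norm_sq cmod_diff_sq)
  also have "\<dots> = (L2_norm (\<lambda>x. g (x + t)))\<^sup>2 + (L2_norm g)\<^sup>2 - 2 * Re (autocorr g t)"
    unfolding autocorr_def integral_Re[OF i, symmetric] L2_norm_sq
    using L2_integrable[OF assms] L2_integrable[OF L2_shift(1)[OF assms, of t]] integrable_Re[OF i]
    by (subst Bochner_Integration.integral_diff) (auto simp del: times_complex.sel)
  finally show ?thesis using L2_shift(2)[OF assms, of t] by (simp add: field_simps)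
qed

text \<open>The real part of a Cauchy-Schwarz bound, read off from \<open>Re_autocorr\<close>: the
  squared translation difference lies between 0 and four times the squared norm. It provides the
  majorant for the Gaussian limit.\<close>

lemma abs_Re_autocorr_le:
  assumes "g \<in> L2_space"
  shows "\<bar>Re (autocorr g t)\<bar> \<le> (L2_norm g)\<^sup>2"
proof -
  have "(L2_norm (\<lambda>x. g (x + t) - g x))\<^sup>2 \<le> 4 * (L2_norm g)\<^sup>2"
    using L2_diff(2)[OF L2_shift(1)[OF assms, of t] assms] L2_shift(2)[OF assms, of t] by simp
  then show ?thesis
    using zero_le_power2[of "L2_norm (\<lambda>x. g (x + t) - g x)"] unfolding Re_autocorr[OF assms] by linarith
qed

lemma Re_autocorr_tendsto:
  assumes "g \<in> L2_space" "t \<longlonglongrightarrow> 0"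
  shows "(\<lambda>n. Re (autocorr g (t n))) \<longlonglongrightarrow> (L2_norm g)\<^sup>2"
proof -
  have "(\<lambda>n. (L2_norm g)\<^sup>2 - (L2_norm (\<lambda>x. g (x + t n) - g x))\<^sup>2 / 2) \<longlonglongrightarrow> (L2_norm g)\<^sup>2 - 0 / 2"
    by (intro tendsto_intros L2_translation_continuous assms) auto
  then show ?thesis by (simp add: Re_autocorr[OF assms(1)])
qed

lemma cmod_exp_ii [simp]: "cmod (exp (- (\<i> * complex_of_real w * complex_of_real x))) = 1"
  "cmod (exp (\<i> * complex_of_real w * complex_of_real x)) = 1"
  by (simp_all add: norm_exp_eq_Re)

text \<open>The convolution theorem: by Fubini the transform of the autocorrelation is the transform
  of \<open>g\<close> times its conjugate. The factor 2 \<pi> undoes the normalisation in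
  \<open>fourier_L1\<close>.\<close>

lemma autocorr_fourier:
  assumes g: "integrable lborel g"
  shows "integrable lborel (autocorr g)" (is ?int)
    and "(\<integral>t. autocorr g t * exp (- \<i> * complex_of_real w * complex_of_real t) \<partial>lborel)
      = complex_of_real (2 * pi * (cmod (fourier_L1 g w))\<^sup>2)" (is ?eq)
proof -
  have [measurable]: "g \<in> borel_measurable borel" using g by auto
  let ?e = "\<lambda>w t. exp (- \<i> * complex_of_real w * complex_of_real t)"
  have shift: "integrable lborel (\<lambda>t. g (x + t))" for x
    using lborel_integrable_real_affine[OF g, of 1 x] by simp
  have intshift: "(\<integral>t. cmod (g (x + t)) \<partial>lborel) = (\<integral>t. cmod (g t) \<partial>lborel)" for x
    by (subst (2) lborel_integral_real_affine[of 1 _ x]) auto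
  \<comment> \<open>The kernel has modulus 1, and the inner integral of the modulus of
    \<open>g (x + t)\<close> is the L1 norm of \<open>g\<close> for every \<open>x\<close>.\<close>
  have int: "integrable (lborel \<Otimes>\<^sub>M lborel) (\<lambda>(x, t). g (x + t) * cnj (g x) * ?e w t)" for w
  proof (rule lborel_pair.Fubini_integrable)
    show "integrable lborel (\<lambda>x. \<integral>t. norm (case (x, t) of (x, t) \<Rightarrow> g (x + t) * cnj (g x) * ?e w t) \<partial>lborel)"
      using integrable_norm[OF g] by (simp add: norm_mult intshift)
    have "integrable lborel (\<lambda>t. g (x + t) * cnj (g x) * ?e w t)" for x
      by (rule Bochner_Integration.integrable_bound[OF integrable_mult_left[OF shift[of x], of "g x"]])
        (auto simp: norm_mult)
    then show "AE x in lborel. integrable lborel (\<lambda>t. case (x, t) of (x, t) \<Rightarrow> g (x + t) * cnj (g x) * ?e w t)"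
      by simp
  qed measurable
  have snd: "(\<integral>x. g (x + t) * cnj (g x) * ?e w t \<partial>lborel) = autocorr g t * ?e w t" for w t
    by (simp add: autocorr_def)
  \<comment> \<open>At frequency 0 the kernel is 1, so integrating out \<open>x\<close> leaves the
    autocorrelation itself.\<close>
  show ?int
    using lborel_pair.integrable_snd[OF int[of 0]] by (simp add: autocorr_def[abs_def])
  have "(\<integral>t. autocorr g t * ?e w t \<partial>lborel) = (\<integral>t. \<integral>x. g (x + t) * cnj (g x) * ?e w t \<partial>lborel \<partial>lborel)"
    by (simp only: snd)
  also have "\<dots> = (\<integral>x. \<integral>t. g (x + t) * cnj (g x) * ?e w t \<partial>lborel \<partial>lborel)"
    by (rule lborel_pair.Fubini_integral[OF int])
  also have "\<dots> = (\<integral>x. (\<integral>t. g t * ?e w t \<partial>lborel) * cnj (g x * ?e w x) \<partial>lborel)"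
  proof (rule Bochner_Integration.integral_cong[OF refl])
    fix x :: real
    \<comment> \<open>Shifting \<open>t\<close> by \<open>x\<close> makes the characters combine:
      the kernel at \<open>x + t\<close> times the conjugate kernel at \<open>x\<close> is the
      kernel at \<open>t\<close>.\<close>
    have "(\<integral>t. g t * ?e w t \<partial>lborel) * cnj (g x * ?e w x)
      = (\<integral>t. g (x + t) * ?e w (x + t) \<partial>lborel) * cnj (g x * ?e w x)"
      by (subst lborel_integral_real_affine[of 1 _ x]) auto
    also have "\<dots> = (\<integral>t. g (x + t) * ?e w (x + t) * cnj (g x * ?e w x) \<partial>lborel)"
      by simp
    also have "\<dots> = (\<integral>t. g (x + t) * cnj (g x) * ?e w t \<partial>lborel)"
      by (intro Bochner_Integration.integral_cong)
        (auto simp: exp_cnj algebra_simps simp flip: exp_add)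
    finally show "(\<integral>t. g (x + t) * cnj (g x) * ?e w t \<partial>lborel)
      = (\<integral>t. g t * ?e w t \<partial>lborel) * cnj (g x * ?e w x)" by simp
  qed
  also have "\<dots> = (\<integral>t. g t * ?e w t \<partial>lborel) * cnj (\<integral>x. g x * ?e w x \<partial>lborel)"
    by (subst integral_mult_right_zero) (simp only: Bochner_Integration.integral_cnj)
  also have "\<dots> = complex_of_real ((cmod (\<integral>t. g t * ?e w t \<partial>lborel))\<^sup>2)"
    by (simp only: complex_norm_square)
  also have "(cmod (\<integral>t. g t * ?e w t \<partial>lborel))\<^sup>2 = 2 * pi * (cmod (fourier_L1 g w))\<^sup>2"
    by (simp add: fourier_L1_def norm_mult norm_divide power_mult_distrib power_divide)
  finally show ?eq .
qed

section \<open>Gaussian means and half of Plancherel's theorem\<close>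

lemma gaussian_fourier:
  assumes "\<sigma> > 0"
  shows "(\<integral>w. complex_of_real (std_normal_density (\<sigma> * w)) * exp (- \<i> * complex_of_real w * complex_of_real t) \<partial>lborel)
    = complex_of_real (sqrt (2 * pi) / \<sigma> * std_normal_density (t / \<sigma>))"
proof -
  \<comment> \<open>\<open>char\<close> has a positive sign in the exponent, hence the evaluation at
    - t / \<sigma>.\<close>
  have "complex_of_real (exp (- ((- t / \<sigma>)\<^sup>2) / 2))
    = (\<integral>w. std_normal_density w *\<^sub>R iexp (- t / \<sigma> * w) \<partial>lborel)"
    unfolding char_std_normal_distribution[THEN fun_cong, symmetric] char_def
    by (rule integral_density) auto
  also have "\<dots> = \<bar>\<sigma>\<bar> *\<^sub>R (\<integral>w. std_normal_density (0 + \<sigma> * w) *\<^sub>R iexp (- t / \<sigma> * (0 + \<sigma> * w)) \<partial>lborel)"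
    using assms by (intro lborel_integral_real_affine) auto
  also have "(\<lambda>w. std_normal_density (0 + \<sigma> * w) *\<^sub>R iexp (- t / \<sigma> * (0 + \<sigma> * w)))
    = (\<lambda>w. complex_of_real (std_normal_density (\<sigma> * w)) * exp (- \<i> * complex_of_real w * complex_of_real t))"
    using assms by (auto simp: scaleR_conv_of_real field_simps)
  finally have "(\<integral>w. complex_of_real (std_normal_density (\<sigma> * w)) * exp (- \<i> * complex_of_real w * complex_of_real t) \<partial>lborel)
    = complex_of_real (exp (- ((- t / \<sigma>)\<^sup>2) / 2) / \<sigma>)"
    using assms by (simp add: scaleR_conv_of_real field_simps)
  also have "exp (- ((- t / \<sigma>)\<^sup>2) / 2) / \<sigma> = sqrt (2 * pi) / \<sigma> * std_normal_density (t / \<sigma>)"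
    by (simp add: std_normal_density_def)
  finally show ?thesis .
qed

lemma integrable_std_normal_density: "integrable lborel std_normal_density"
  by simp

text \<open>The multiplication formula: Fubini moves the transform from the autocorrelation onto the
  Gaussian. The substitution t = \<sigma> s then frees the weight on the right of \<sigma>, so that
  the limit \<sigma> -> 0 affects only the argument of \<open>autocorr\<close>.\<close>

lemma gaussian_mean_fourier:
  assumes g: "integrable lborel g" and "\<sigma> > 0"
  shows "complex_of_real (\<integral>w. 2 * pi * (cmod (fourier_L1 g w))\<^sup>2 * std_normal_density (\<sigma> * w) \<partial>lborel)
    = sqrt (2 * pi) * (\<integral>s. autocorr g (\<sigma> * s) * std_normal_density s \<partial>lborel)"
proof -
  let ?R = "autocorr g" and ?N = "\<lambda>w. complex_of_real (std_normal_density w)"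
  let ?e = "\<lambda>w t. exp (- \<i> * complex_of_real w * complex_of_real t)"
  have R: "integrable lborel ?R" by (rule autocorr_fourier[OF g])
  then have [measurable]: "?R \<in> borel_measurable borel" by auto
  have N: "integrable lborel (\<lambda>w. std_normal_density (\<sigma> * w))"
    using lborel_integrable_real_affine[OF integrable_std_normal_density, of \<sigma> 0] assms(2) by simp
  have int: "integrable (lborel \<Otimes>\<^sub>M lborel) (\<lambda>(t, w). ?R t * (?N (\<sigma> * w) * ?e w t))"
  proof (rule lborel_pair.Fubini_integrable)
    show "integrable lborel (\<lambda>t. \<integral>w. norm (case (t, w) of (t, w) \<Rightarrow> ?R t * (?N (\<sigma> * w) * ?e w t)) \<partial>lborel)"
      using integrable_norm[OF R] by (simp add: norm_mult)
    have "integrable lborel (\<lambda>w. ?R t * (?N (\<sigma> * w) * ?e w t))" for t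
      by (rule Bochner_Integration.integrable_bound[OF integrable_mult_left[OF N, of "cmod (?R t)"]])
        (auto simp: norm_mult)
    then show "AE t in lborel. integrable lborel (\<lambda>w. case (t, w) of (t, w) \<Rightarrow> ?R t * (?N (\<sigma> * w) * ?e w t))"
      by simp
  qed measurable
  have "complex_of_real (\<integral>w. 2 * pi * (cmod (fourier_L1 g w))\<^sup>2 * std_normal_density (\<sigma> * w) \<partial>lborel)
    = (\<integral>w. complex_of_real (2 * pi * (cmod (fourier_L1 g w))\<^sup>2) * ?N (\<sigma> * w) \<partial>lborel)"
    by (simp only: integral_complex_of_real[symmetric] of_real_mult)
  also have "\<dots> = (\<integral>w. (\<integral>t. ?R t * (?N (\<sigma> * w) * ?e w t) \<partial>lborel) \<partial>lborel)"
  proof (rule Bochner_Integration.integral_cong[OF refl])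
    fix w
    have "complex_of_real (2 * pi * (cmod (fourier_L1 g w))\<^sup>2) * ?N (\<sigma> * w) = (\<integral>t. ?R t * ?e w t * ?N (\<sigma> * w) \<partial>lborel)"
      by (simp only: autocorr_fourier(2)[OF g, symmetric] integral_mult_left_zero)
    then show "complex_of_real (2 * pi * (cmod (fourier_L1 g w))\<^sup>2) * ?N (\<sigma> * w) = (\<integral>t. ?R t * (?N (\<sigma> * w) * ?e w t) \<partial>lborel)"
      by (simp only: mult_ac)
  qed
  also have "\<dots> = (\<integral>t. (\<integral>w. ?R t * (?N (\<sigma> * w) * ?e w t) \<partial>lborel) \<partial>lborel)"
    by (rule lborel_pair.Fubini_integral[OF int])
  also have "\<dots> = (\<integral>t. ?R t * (sqrt (2 * pi) / \<sigma> * std_normal_density (t / \<sigma>)) \<partial>lborel)"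
    by (simp only: integral_mult_right_zero gaussian_fourier[OF assms(2)])
  also have "\<dots> = \<bar>\<sigma>\<bar> *\<^sub>R (\<integral>s. ?R (0 + \<sigma> * s) * (sqrt (2 * pi) / \<sigma> * std_normal_density ((0 + \<sigma> * s) / \<sigma>)) \<partial>lborel)"
    using assms(2) by (intro lborel_integral_real_affine) auto
  also have "(\<lambda>s. ?R (0 + \<sigma> * s) * (sqrt (2 * pi) / \<sigma> * std_normal_density ((0 + \<sigma> * s) / \<sigma>)))
    = (\<lambda>s. (sqrt (2 * pi) / \<sigma>) * (?R (\<sigma> * s) * std_normal_density s))"
    using assms(2) by auto
  also have "\<bar>\<sigma>\<bar> *\<^sub>R (\<integral>s. (sqrt (2 * pi) / \<sigma>) * (?R (\<sigma> * s) * std_normal_density s) \<partial>lborel)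
    = sqrt (2 * pi) * (\<integral>s. ?R (\<sigma> * s) * std_normal_density s \<partial>lborel)"
    using assms(2) by (simp only: integral_mult_right_zero) (simp add: scaleR_conv_of_real)
  finally show ?thesis .
qed

text \<open>In \<open>gaussian_mean_fourier\<close> with \<sigma> -> 0 the autocorrelation side
  tends to a multiple of the squared norm of \<open>g\<close>, while the frequency side stays below
  the same multiple of the squared norm of the transform, the Gaussian being at most its value at
  0.\<close>

lemma L2_norm_le_fourier:
  assumes g: "integrable lborel g" "g \<in> L2_space" and G: "fourier_L1 g \<in> L2_space"
  shows "L2_norm g \<le> L2_norm (fourier_L1 g)"
proof -
  define \<sigma> where "\<sigma> n = inverse (real (Suc n))" for n
  have \<sigma>: "\<sigma> n > 0" for n by (simp add: \<sigma>_def)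
  have \<sigma>0: "\<sigma> \<longlonglongrightarrow> 0" unfolding \<sigma>_def by (rule LIMSEQ_inverse_real_of_nat)
  note [measurable] = L2_measurable[OF g(2)] L2_measurable[OF G]
  have [measurable]: "autocorr g \<in> borel_measurable borel"
    using autocorr_fourier(1)[OF g(1)] by auto
  have Nle: "std_normal_density x \<le> 1 / sqrt (2 * pi)" for x
    by (simp add: std_normal_density_def divide_right_mono)
  have bound: "(\<integral>s. Re (autocorr g (\<sigma> n * s)) * std_normal_density s \<partial>lborel) \<le> (L2_norm (fourier_L1 g))\<^sup>2" for n
  proof -
    let ?R = "\<lambda>s. autocorr g (\<sigma> n * s) * complex_of_real (std_normal_density s)"
    have "integrable lborel (\<lambda>s. autocorr g (\<sigma> n * s))"
      using lborel_integrable_real_affine[OF autocorr_fourier(1)[OF g(1)], of "\<sigma> n" 0] \<sigma>[of n] by simp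
    then have "integrable lborel (\<lambda>s. autocorr g (\<sigma> n * s) * complex_of_real (1 / sqrt (2 * pi)))"
      by (rule integrable_mult_left)
    then have int: "integrable lborel ?R"
    proof (rule Bochner_Integration.integrable_bound)
      have "cmod (?R s) \<le> cmod (autocorr g (\<sigma> n * s) * complex_of_real (1 / sqrt (2 * pi)))" for s
        unfolding norm_mult norm_of_real using Nle[of s] by (intro mult_left_mono) auto
      then show "AE s in lborel. cmod (?R s)
        \<le> cmod (autocorr g (\<sigma> n * s) * complex_of_real (1 / sqrt (2 * pi)))" by blast
    qed measurable
    have "sqrt (2 * pi) * (\<integral>s. Re (autocorr g (\<sigma> n * s)) * std_normal_density s \<partial>lborel)
      = Re (sqrt (2 * pi) * (\<integral>s. ?R s \<partial>lborel))"
      using integral_Re[OF int] by simp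
    also have "\<dots> = (\<integral>w. 2 * pi * (cmod (fourier_L1 g w))\<^sup>2 * std_normal_density (\<sigma> n * w) \<partial>lborel)"
      unfolding gaussian_mean_fourier[OF g(1) \<sigma>, symmetric] by simp
    \<comment> \<open>The density is replaced by its maximum; 2 \<pi> divided by its square root is
      the factor that cancels on the left.\<close>
    also have "\<dots> \<le> (\<integral>w. 2 * pi * (cmod (fourier_L1 g w))\<^sup>2 * (1 / sqrt (2 * pi)) \<partial>lborel)"
    proof (rule integral_mono')
      show "integrable lborel (\<lambda>w. 2 * pi * (cmod (fourier_L1 g w))\<^sup>2 * (1 / sqrt (2 * pi)))"
        using L2_integrable[OF G] by simp
      show "2 * pi * (cmod (fourier_L1 g w))\<^sup>2 * std_normal_density (\<sigma> n * w)
        \<le> 2 * pi * (cmod (fourier_L1 g w))\<^sup>2 * (1 / sqrt (2 * pi))" for w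
        by (intro mult_left_mono Nle) auto
    qed auto
    also have "\<dots> = sqrt (2 * pi) * (L2_norm (fourier_L1 g))\<^sup>2"
      using real_div_sqrt[of "2 * pi"] by (simp add: L2_norm_sq field_simps)
    finally show ?thesis by simp
  qed
  \<comment> \<open>The limit integral is the squared norm of \<open>g\<close>, as the normal
    density has mass 1.\<close>
  have "(\<lambda>n. \<integral>s. Re (autocorr g (\<sigma> n * s)) * std_normal_density s \<partial>lborel)
    \<longlonglongrightarrow> (\<integral>s. (L2_norm g)\<^sup>2 * std_normal_density s \<partial>lborel)"
  proof (rule integral_dominated_convergence[where w="\<lambda>s. (L2_norm g)\<^sup>2 * std_normal_density s"])
    show "AE s in lborel. (\<lambda>n. Re (autocorr g (\<sigma> n * s)) * std_normal_density s)
      \<longlonglongrightarrow> (L2_norm g)\<^sup>2 * std_normal_density s"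
      using tendsto_mult_right[OF \<sigma>0] by (intro AE_I2 tendsto_intros Re_autocorr_tendsto g) auto
    show "AE s in lborel. norm (Re (autocorr g (\<sigma> n * s)) * std_normal_density s)
      \<le> (L2_norm g)\<^sup>2 * std_normal_density s" for n
      using abs_Re_autocorr_le[OF g(2)] by (auto simp: abs_mult intro!: mult_right_mono)
  qed auto
  then have "(\<integral>s. (L2_norm g)\<^sup>2 * std_normal_density s \<partial>lborel) \<le> (L2_norm (fourier_L1 g))\<^sup>2"
    using bound by (intro LIMSEQ_le_const2) auto
  then have "(L2_norm g)\<^sup>2 \<le> (L2_norm (fourier_L1 g))\<^sup>2" by simp
  then show ?thesis by (rule power2_le_imp_le) (rule L2_norm_nonneg)
qed

section \<open>Modulations and the modulus of continuity\<close>

lemma fourier_L1_modulate: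
  "fourier_L1 (\<lambda>x. exp (\<i> * complex_of_real \<eta> * complex_of_real x) * g x) w = fourier_L1 g (w - \<eta>)"
proof -
  have "exp (- \<i> * complex_of_real (w - \<eta>) * complex_of_real x)
    = exp (\<i> * complex_of_real \<eta> * complex_of_real x) * exp (- \<i> * complex_of_real w * complex_of_real x)" for x
    by (simp add: algebra_simps flip: exp_add)
  then show ?thesis by (simp only: fourier_L1_def mult_ac)
qed

text \<open>Needed because a real \<open>SUP\<close> dominates its members only over a set that is
  bounded above.\<close>

lemma modulus_L2_bdd_above:
  assumes "F \<in> L2_space"
  shows "bdd_above ((\<lambda>\<eta>. L2_norm (\<lambda>x. F (x - \<eta>) - F x)) ` A)"
proof (rule bdd_aboveI2)
  fix \<eta>
  have "(L2_norm (\<lambda>x. F (x + - \<eta>) - F x))\<^sup>2 \<le> 2 * (L2_norm (\<lambda>x. F (x + - \<eta>)))\<^sup>2 + 2 * (L2_norm F)\<^sup>2"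
    by (intro L2_diff L2_shift assms)
  also have "\<dots> = (2 * L2_norm F)\<^sup>2"
    unfolding L2_shift(2)[OF assms] by (simp add: power_mult_distrib)
  finally have "L2_norm (\<lambda>x. F (x + - \<eta>) - F x) \<le> 2 * L2_norm F"
    by (rule power2_le_imp_le) (simp add: L2_norm_nonneg)
  then show "L2_norm (\<lambda>x. F (x - \<eta>) - F x) \<le> 2 * L2_norm F" by simp
qed

text \<open>For the L1 approximants \<open>g n\<close>, multiplication by \<open>m\<close> becomes
  the translation difference \<open>D\<close> of the transform, so \<open>L2_norm_le_fourier\<close>
  applies. Both operations are bounded on L2, and the estimate passes to the limit. The factor 2 is
  the price of the two splittings.\<close>

lemma L2_norm_modulate_le:
  assumes "has_fourier_L2 f F"
  shows "L2_norm (\<lambda>x. (exp (\<i> * complex_of_real \<eta> * complex_of_real x) - 1) * f x)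
    \<le> 2 * modulus_L2 F \<bar>\<eta>\<bar>"
proof -
  obtain g where g: "\<And>n. integrable lborel (g n)" "tendsto_L2 g f" "tendsto_L2 (\<lambda>n. fourier_L1 (g n)) F"
    using assms unfolding has_fourier_L2_def by blast
  have gL: "g n \<in> L2_space" "fourier_L1 (g n) \<in> L2_space" for n
    using g unfolding tendsto_L2_def by auto
  have fL: "f \<in> L2_space" and FL: "F \<in> L2_space"
    using g unfolding tendsto_L2_def by auto
  define m where "m x = exp (\<i> * complex_of_real \<eta> * complex_of_real x) - 1" for x :: real
  have [measurable]: "m \<in> borel_measurable borel" unfolding m_def by measurable
  have m2: "cmod (m x) \<le> 2" for x
    using norm_triangle_ineq4[of "exp (\<i> * complex_of_real \<eta> * complex_of_real x)" 1] by (simp add: m_def)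
  have mul: "(\<lambda>x. m x * h x) \<in> L2_space" "(L2_norm (\<lambda>x. m x * h x))\<^sup>2 \<le> 2\<^sup>2 * (L2_norm h)\<^sup>2"
    if h: "h \<in> L2_space" for h
    using L2_measurable[OF h] m2
    by (intro L2_dominated[OF h, where K=2]; auto simp: norm_mult intro: mult_right_mono)+
  define D where "D h w = h (w - \<eta>) - h w" for h :: "real \<Rightarrow> complex" and w
  have D: "D h \<in> L2_space" "(L2_norm (D h))\<^sup>2 \<le> 4 * (L2_norm h)\<^sup>2" if h: "h \<in> L2_space" for h
  proof -
    have e: "D h = (\<lambda>w. h (w + - \<eta>) - h w)" by (auto simp: D_def)
    show "D h \<in> L2_space" unfolding e by (intro L2_diff L2_shift h)
    have "(L2_norm (D h))\<^sup>2 \<le> 2 * (L2_norm (\<lambda>w. h (w + - \<eta>)))\<^sup>2 + 2 * (L2_norm h)\<^sup>2"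
      unfolding e by (intro L2_diff L2_shift h)
    then show "(L2_norm (D h))\<^sup>2 \<le> 4 * (L2_norm h)\<^sup>2"
      by (simp only: L2_shift(2)[OF h])
  qed
  \<comment> \<open>Splitting \<open>f\<close> into \<open>g n\<close> and an error gives 2 and 2 *
    4 = 8. Splitting the transform of \<open>g n\<close> into \<open>F\<close> and an error turns
    the 2 into 2 * 2 = 4 and 2 * 2 * 4 = 16.\<close>
  have step: "(L2_norm (\<lambda>x. m x * f x))\<^sup>2
    \<le> 4 * (L2_norm (D F))\<^sup>2 + (16 * (L2_norm (\<lambda>w. fourier_L1 (g n) w - F w))\<^sup>2
      + 8 * (L2_norm (\<lambda>x. g n x - f x))\<^sup>2)" for n
  proof -
    have eint: "integrable lborel (\<lambda>x. exp (\<i> * complex_of_real \<eta> * complex_of_real x) * g n x)"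
      by (rule Bochner_Integration.integrable_bound[OF g(1)[of n]])
        (use L2_measurable[OF gL(1)] in \<open>auto simp: norm_mult\<close>)
    have mint: "integrable lborel (\<lambda>x. m x * g n x)"
      using Bochner_Integration.integrable_diff[OF eint g(1)[of n]] by (simp add: m_def left_diff_distrib)
    have expint: "integrable lborel (\<lambda>x. h x * exp (- \<i> * complex_of_real w * complex_of_real x))"
      if "integrable lborel h" for h w
      by (rule Bochner_Integration.integrable_bound[OF that])
        (use borel_measurable_integrable[OF that] in \<open>auto simp: norm_mult\<close>)
    have four: "fourier_L1 (\<lambda>x. m x * g n x) = D (fourier_L1 (g n))"
    proof
      fix w
      have "fourier_L1 (\<lambda>x. m x * g n x) w
        = fourier_L1 (\<lambda>x. exp (\<i> * complex_of_real \<eta> * complex_of_real x) * g n x) w - fourier_L1 (g n) w"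
        using Bochner_Integration.integral_diff[OF expint[OF eint, of w] expint[OF g(1)[of n], of w]]
        by (simp add: fourier_L1_def m_def left_diff_distrib diff_divide_distrib)
      then show "fourier_L1 (\<lambda>x. m x * g n x) w = D (fourier_L1 (g n)) w"
        by (simp add: fourier_L1_modulate D_def)
    qed
    have "L2_norm (\<lambda>x. m x * g n x) \<le> L2_norm (D (fourier_L1 (g n)))"
      unfolding four[symmetric]
      by (rule L2_norm_le_fourier[OF mint mul(1)[OF gL(1)]]) (simp add: four D gL)
    then have 1: "(L2_norm (\<lambda>x. m x * g n x))\<^sup>2 \<le> (L2_norm (D (fourier_L1 (g n))))\<^sup>2"
      by (intro power_mono L2_norm_nonneg)
    have 2: "(L2_norm (\<lambda>x. m x * f x))\<^sup>2
      \<le> 2 * (L2_norm (\<lambda>x. m x * g n x))\<^sup>2 + 2 * (L2_norm (\<lambda>x. m x * f x - m x * g n x))\<^sup>2"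
      by (intro L2_norm_le_split mul fL gL)
    have 3: "(L2_norm (\<lambda>x. m x * f x - m x * g n x))\<^sup>2 \<le> 4 * (L2_norm (\<lambda>x. g n x - f x))\<^sup>2"
      using mul(2)[OF L2_diff(1)[OF fL gL(1)[of n]]] L2_norm_minus_commute[of f "g n"]
      by (simp add: right_diff_distrib)
    have 4: "(L2_norm (D (fourier_L1 (g n))))\<^sup>2
      \<le> 2 * (L2_norm (D F))\<^sup>2 + 2 * (L2_norm (\<lambda>w. D (fourier_L1 (g n)) w - D F w))\<^sup>2"
      by (intro L2_norm_le_split D FL gL)
    have "(\<lambda>w. D (fourier_L1 (g n)) w - D F w) = D (\<lambda>w. fourier_L1 (g n) w - F w)"
      by (auto simp: D_def)
    then have 5: "(L2_norm (\<lambda>w. D (fourier_L1 (g n)) w - D F w))\<^sup>2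
      \<le> 4 * (L2_norm (\<lambda>w. fourier_L1 (g n) w - F w))\<^sup>2"
      by (simp only:) (intro D L2_diff gL FL)
    from 1 2 3 4 5 show ?thesis by linarith
  qed
  have "(\<lambda>n. 4 * (L2_norm (D F))\<^sup>2 + (16 * (L2_norm (\<lambda>w. fourier_L1 (g n) w - F w))\<^sup>2
      + 8 * (L2_norm (\<lambda>x. g n x - f x))\<^sup>2)) \<longlonglongrightarrow> 4 * (L2_norm (D F))\<^sup>2 + (16 * 0\<^sup>2 + 8 * 0\<^sup>2)"
    using g(2,3) unfolding tendsto_L2_def by (intro tendsto_intros) auto
  then have "(L2_norm (\<lambda>x. m x * f x))\<^sup>2 \<le> (2 * L2_norm (D F))\<^sup>2"
    using step by (intro LIMSEQ_le_const) (auto simp: power_mult_distrib)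
  then have "L2_norm (\<lambda>x. m x * f x) \<le> 2 * L2_norm (D F)"
    by (rule power2_le_imp_le) (simp add: L2_norm_nonneg)
  also have "L2_norm (D F) \<le> modulus_L2 F \<bar>\<eta>\<bar>"
    unfolding modulus_L2_def D_def
    by (rule cSUP_upper[OF _ modulus_L2_bdd_above[OF FL]]) simp
  finally show ?thesis by (simp add: m_def)
qed

section \<open>The flipping operator and its Blaschke factors\<close>

text \<open>The factor \<open>a / cnj a\<close> is kept apart because it is unimodular and can be
  absorbed into \<open>c\<close>. For real \<open>x\<close> the denominators do not vanish, as
  \<open>a\<close> lies off the real axis.\<close>

lemma flip_eq:
  assumes "Im a > 0"
  shows "flip a f x = (a / cnj a) * ((cnj a - complex_of_real x) / (a - complex_of_real x))
    * exp (\<i> * complex_of_real (2 * Im a / (cmod a)\<^sup>2) * complex_of_real x) * f x"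
proof -
  have nz: "a \<noteq> 0" "a - complex_of_real x \<noteq> 0" using assms by (auto simp: complex_eq_iff)
  have "complex_of_real x / cnj a - complex_of_real x / a
    = \<i> * complex_of_real (2 * Im a / (cmod a)\<^sup>2) * complex_of_real x"
  proof -
    have "complex_of_real x / cnj a - complex_of_real x / a = complex_of_real x * (a - cnj a) / (a * cnj a)"
      using nz by (simp add: field_simps)
    also have "\<dots> = complex_of_real x * (complex_of_real (2 * Im a) * \<i>) / complex_of_real ((cmod a)\<^sup>2)"
      by (simp only: complex_diff_cnj complex_norm_square)
    finally show ?thesis by simp
  qed
  then have "exp (complex_of_real x / cnj a) / exp (complex_of_real x / a)
    = exp (\<i> * complex_of_real (2 * Im a / (cmod a)\<^sup>2) * complex_of_real x)"
    by (simp only: exp_diff[symmetric])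
  moreover have "(1 - complex_of_real x / cnj a) / (1 - complex_of_real x / a)
    = (a / cnj a) * ((cnj a - complex_of_real x) / (a - complex_of_real x))"
  proof -
    have "1 - complex_of_real x / cnj a = (cnj a - complex_of_real x) / cnj a"
      "1 - complex_of_real x / a = (a - complex_of_real x) / a"
      using nz by (auto simp: diff_divide_distrib)
    then show ?thesis by simp
  qed
  ultimately show ?thesis by (simp only: flip_def)
qed

text \<open>With p = a - x, the factor for \<open>a\<close> is 1 - 2 i \<open>Im a\<close> / p, and
  likewise for \<open>b\<close> with q = b - x. In the difference \<open>Im b\<close> occurs only
  over q, whose modulus is at least \<open>Im b\<close>; what remains is divided by p, whose modulus
  is at least \<open>Im a\<close>.\<close>

lemma blaschke_diff_le:
  assumes a: "Im a > 0" and b: "Im b > 0"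
  shows "cmod ((cnj a - complex_of_real x) / (a - complex_of_real x)
    - (cnj b - complex_of_real x) / (b - complex_of_real x)) \<le> 4 * cmod (a - b) / Im a"
proof -
  define p q where "p = a - complex_of_real x" and "q = b - complex_of_real x"
  have p: "p \<noteq> 0" "Im a \<le> cmod p" and q: "q \<noteq> 0" "Im b \<le> cmod q"
    using a b abs_Im_le_cmod[of p] abs_Im_le_cmod[of q] by (auto simp: p_def q_def complex_eq_iff)
  have alg: "(p - 2 * \<i> * \<alpha>) / p - (q - 2 * \<i> * \<beta>) / q = 2 * \<i> * ((\<beta> - \<alpha>) / p + \<beta> * (p - q) / (p * q))" for \<alpha> \<beta>
    using p(1) q(1) by (simp add: field_simps)
  have "cnj a - complex_of_real x = p - 2 * \<i> * complex_of_real (Im a)"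
    "cnj b - complex_of_real x = q - 2 * \<i> * complex_of_real (Im b)" "p - q = a - b"
    by (auto simp: p_def q_def complex_eq_iff)
  then have "(cnj a - complex_of_real x) / p - (cnj b - complex_of_real x) / q
    = 2 * \<i> * (complex_of_real (Im b - Im a) / p + complex_of_real (Im b) * (a - b) / (p * q))"
    using alg[of "complex_of_real (Im a)" "complex_of_real (Im b)"] by (simp only: of_real_diff)
  also have "cmod \<dots> \<le> 2 * (\<bar>Im b - Im a\<bar> / cmod p + Im b * cmod (a - b) / (cmod p * cmod q))"
    using norm_triangle_ineq[of "complex_of_real (Im b - Im a) / p" "complex_of_real (Im b) * (a - b) / (p * q)"] b
    by (simp only: norm_mult norm_divide norm_of_real norm_ii norm_numeral) simp
  also have "\<dots> \<le> 2 * (cmod (a - b) / Im a + cmod (a - b) / Im a)"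
  proof (intro mult_left_mono add_mono)
    show "\<bar>Im b - Im a\<bar> / cmod p \<le> cmod (a - b) / Im a"
      using a p abs_Im_le_cmod[of "a - b"] by (intro frac_le) (auto simp: abs_minus_commute)
    have "Im b / cmod q \<le> 1" using b q by simp
    then have "cmod (a - b) / cmod p * (Im b / cmod q) \<le> cmod (a - b) / cmod p * 1"
      by (intro mult_left_mono) auto
    also have "\<dots> \<le> cmod (a - b) / Im a" using a p by (auto intro!: frac_le)
    finally show "Im b * cmod (a - b) / (cmod p * cmod q) \<le> cmod (a - b) / Im a"
      by (simp add: mult_ac)
  qed simp
  finally show ?thesis by (simp add: p_def q_def)
qed

text \<open>The chosen \<open>c\<close> gives both terms the same constant \<open>a / cnj a\<close>.
  Exchanging the Blaschke factors first and the exponentials afterwards leaves two errors,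
  \<open>u\<close> and - \<open>v\<close>, estimated separately.\<close>

lemma flip_distance_le:
  assumes f: "f \<in> L2_space" and F: "has_fourier_L2 f F" and a: "Im a > 0" and b: "Im b > 0"
  shows "(L2_norm (\<lambda>x. flip a f x - (a / cnj a) / (b / cnj b) * flip b f x))\<^sup>2
    \<le> 8 * modulus_L2 F \<bar>2 * Im b / (cmod b)\<^sup>2 - 2 * Im a / (cmod a)\<^sup>2\<bar> * L2_norm f
      + 32 * (cmod (a - b) / Im a)\<^sup>2 * (L2_norm f)\<^sup>2"
proof -
  note [measurable] = L2_measurable[OF f]
  define \<beta>a \<beta>b where "\<beta>a = 2 * Im a / (cmod a)\<^sup>2" and "\<beta>b = 2 * Im b / (cmod b)\<^sup>2"
  define A where "A x = (cnj a - complex_of_real x) / (a - complex_of_real x)" for x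
  define B where "B x = (cnj b - complex_of_real x) / (b - complex_of_real x)" for x
  define E where "E \<beta> x = exp (\<i> * complex_of_real \<beta> * complex_of_real x)" for \<beta> x :: real
  have [measurable]: "A \<in> borel_measurable borel" "B \<in> borel_measurable borel"
    "E \<beta> \<in> borel_measurable borel" for \<beta>
    unfolding A_def B_def E_def by measurable
  define u where "u x = (a / cnj a) * (A x - B x) * E \<beta>a x * f x" for x
  define d where "d x = (E (\<beta>a - \<beta>b) x - 1) * f x" for x
  have [measurable]: "u \<in> borel_measurable borel" "d \<in> borel_measurable borel"
    unfolding u_def d_def by measurable
  have nz: "a \<noteq> 0" "b \<noteq> 0" using a b by auto
  have unim: "cmod (a / cnj a) = 1" using nz by (simp add: norm_divide)
  have B1: "cmod (B x) = 1" for x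
  proof -
    have "b - complex_of_real x \<noteq> 0" using b by (auto simp: complex_eq_iff)
    moreover have "cnj b - complex_of_real x = cnj (b - complex_of_real x)" by simp
    ultimately show ?thesis unfolding B_def by (simp only: norm_divide complex_mod_cnj) simp
  qed
  have E1: "cmod (E \<beta> x) = 1" for \<beta> x by (simp add: E_def)
  have dL: "d \<in> L2_space"
  proof (rule L2_dominated(1)[OF f, where K=2])
    show "cmod (d x) \<le> 2 * cmod (f x)" for x
      using norm_triangle_ineq4[of "E (\<beta>a - \<beta>b) x" 1]
      by (auto simp: d_def norm_mult E1 intro!: mult_right_mono)
  qed measurable
  have d2: "(L2_norm d)\<^sup>2 \<le> 2\<^sup>2 * (L2_norm f)\<^sup>2"
  proof (rule L2_dominated(2)[OF f])
    show "cmod (d x) \<le> 2 * cmod (f x)" for x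
      using norm_triangle_ineq4[of "E (\<beta>a - \<beta>b) x" 1]
      by (auto simp: d_def norm_mult E1 intro!: mult_right_mono)
  qed measurable
  have uL: "u \<in> L2_space" "(L2_norm u)\<^sup>2 \<le> (4 * cmod (a - b) / Im a)\<^sup>2 * (L2_norm f)\<^sup>2"
  proof -
    have le: "cmod (u x) \<le> (4 * cmod (a - b) / Im a) * cmod (f x)" for x
      using mult_right_mono[OF blaschke_diff_le[OF a b, of x], of "cmod (f x)"]
      unfolding u_def norm_mult unim E1 by (simp add: A_def B_def)
    show "u \<in> L2_space" "(L2_norm u)\<^sup>2 \<le> (4 * cmod (a - b) / Im a)\<^sup>2 * (L2_norm f)\<^sup>2"
      by (rule L2_dominated[OF f _ le], measurable)+
  qed
  \<comment> \<open>The minus sign brings the decomposition into the form u - v required by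
    \<open>L2_diff\<close>.\<close>
  define v where "v x = - ((a / cnj a) * B x * E \<beta>b x * d x)" for x
  have vL: "v \<in> L2_space" "(L2_norm v)\<^sup>2 \<le> 1\<^sup>2 * (L2_norm d)\<^sup>2"
  proof -
    have le: "cmod (v x) \<le> 1 * cmod (d x)" for x
      unfolding v_def norm_minus_cancel norm_mult unim E1 B1 by simp
    have meas: "v \<in> borel_measurable borel"
      unfolding v_def by measurable
    show "v \<in> L2_space" "(L2_norm v)\<^sup>2 \<le> 1\<^sup>2 * (L2_norm d)\<^sup>2"
      by (rule L2_dominated[OF dL meas le])+
  qed
  have "flip a f x - (a / cnj a) / (b / cnj b) * flip b f x = u x - v x" for x
  proof -
    have "E \<beta>b x * E (\<beta>a - \<beta>b) x = E \<beta>a x"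
      by (simp add: E_def algebra_simps flip: exp_add)
    then have "E \<beta>b x * d x = E \<beta>a x * f x - E \<beta>b x * f x"
      by (simp add: d_def algebra_simps)
    then have "v x = - ((a / cnj a) * B x * (E \<beta>a x * f x - E \<beta>b x * f x))"
      by (simp only: v_def mult.assoc)
    moreover have "flip a f x = (a / cnj a) * A x * E \<beta>a x * f x"
      unfolding flip_eq[OF a] by (simp add: A_def E_def \<beta>a_def)
    moreover have "(a / cnj a) / (b / cnj b) * flip b f x = (a / cnj a) * B x * E \<beta>b x * f x"
      unfolding flip_eq[OF b] using nz by (simp add: B_def E_def \<beta>b_def)
    moreover have "k * p * r * z - k * q * s * z = k * (p - q) * r * z - - (k * q * (r * z - s * z))"
      for k p q r s z :: complex by (simp add: algebra_simps)
    ultimately show ?thesis by (simp only: u_def)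
  qed
  then have "(L2_norm (\<lambda>x. flip a f x - (a / cnj a) / (b / cnj b) * flip b f x))\<^sup>2
    \<le> 2 * (L2_norm u)\<^sup>2 + 2 * (L2_norm v)\<^sup>2"
    by (simp only:) (intro L2_diff uL vL)
  also have "\<dots> \<le> 2 * ((4 * cmod (a - b) / Im a)\<^sup>2 * (L2_norm f)\<^sup>2) + 2 * (L2_norm d)\<^sup>2"
    using uL(2) vL(2) by (intro add_mono mult_left_mono) (simp_all only: power_one mult_1)
  \<comment> \<open>One factor of the square is bounded by the modulus of continuity and the other
    by the norm of \<open>f\<close>, which makes the estimate linear in the modulus. The product,
    doubled, gives the constant 8.\<close>
  also have "(L2_norm d)\<^sup>2 \<le> (2 * modulus_L2 F \<bar>\<beta>a - \<beta>b\<bar>) * (2 * L2_norm f)"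
  proof -
    have "L2_norm d \<le> 2 * L2_norm f"
      by (rule power2_le_imp_le) (use d2 in \<open>simp_all only: power_mult_distrib\<close>, simp add: L2_norm_nonneg)
    moreover have "L2_norm d \<le> 2 * modulus_L2 F \<bar>\<beta>a - \<beta>b\<bar>"
      unfolding d_def E_def by (rule L2_norm_modulate_le[OF F])
    ultimately show ?thesis
      unfolding power2_eq_square using L2_norm_nonneg[of d] by (intro mult_mono) auto
  qed
  finally show ?thesis
    by (simp add: \<beta>a_def \<beta>b_def abs_minus_commute power_mult_distrib power_divide)
qed

theorem theorem3p8:
  fixes L :: real
  assumes "L > 0"
  shows "\<exists>(C1 :: complex \<Rightarrow> real) (C2 :: complex \<Rightarrow> complex \<Rightarrow> real).
    (\<forall>b. Im b > 0 \<longrightarrow> C1 b > 0) \<and>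
    (\<forall>a b. Im a > 0 \<and> Im b > 0 \<and> cmod (a - b) \<le> cmod b / 2 \<longrightarrow> C2 a b \<ge> 0) \<and>
    (\<forall>b. Im b > 0 \<longrightarrow>
       ((\<lambda>a. C2 a b) \<longlongrightarrow> 0) (at b within {a. Im a > 0 \<and> cmod (a - b) \<le> cmod b / 2})) \<and>
    (\<forall>f \<in> PW L. \<forall>fhat. has_fourier_L2 f fhat \<longrightarrow>
      (\<forall>a b. Im a > 0 \<and> Im b > 0 \<and> cmod (a - b) \<le> cmod b / 2 \<longrightarrow>
        (let \<beta>a = 2 * Im a / (cmod a)\<^sup>2; \<beta>b = 2 * Im b / (cmod b)\<^sup>2 in
          (INF c\<in>{c. cmod c = 1}. (L2_norm (\<lambda>x. flip a f x - c * flip b f x))\<^sup>2)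
            \<le> C1 b * modulus_L2 fhat \<bar>\<beta>b - \<beta>a\<bar> * L2_norm f + C2 a b * (L2_norm f)\<^sup>2)))"
proof (intro exI conjI allI impI ballI)
  \<comment> \<open>Both constants are those of \<open>flip_distance_le\<close>. The second tends to
    0 because \<open>Im a\<close> tends to \<open>Im b\<close>, which is positive.\<close>
  let ?C1 = "\<lambda>b::complex. 8 :: real" and ?C2 = "\<lambda>a b. 32 * (cmod (a - b) / Im a)\<^sup>2"
  show "0 < ?C1 b" for b by simp
  show "0 \<le> ?C2 a b" for a b by simp
  show "((\<lambda>a. ?C2 a b) \<longlongrightarrow> 0) (at b within {a. Im a > 0 \<and> cmod (a - b) \<le> cmod b / 2})"
    if "Im b > 0" for b
  proof -
    have "((\<lambda>a. ?C2 a b) \<longlongrightarrow> 32 * (cmod (b - b) / Im b)\<^sup>2)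
      (at b within {a. Im a > 0 \<and> cmod (a - b) \<le> cmod b / 2})"
      using that by (intro tendsto_intros) auto
    then show ?thesis by simp
  qed
  fix f fhat a b
  assume f: "f \<in> PW L" and F: "has_fourier_L2 f fhat"
    and ab: "Im a > 0 \<and> Im b > 0 \<and> cmod (a - b) \<le> cmod b / 2"
  have fL: "f \<in> L2_space" using f by (simp add: PW_def)
  have "cmod ((a / cnj a) / (b / cnj b)) = 1"
    using ab by (simp only: norm_divide complex_mod_cnj) auto
  \<comment> \<open>The infimum is at most its value at this unimodular constant; 0 is the lower
    bound that makes the real infimum meaningful.\<close>
  then have "(INF c\<in>{c. cmod c = 1}. (L2_norm (\<lambda>x. flip a f x - c * flip b f x))\<^sup>2)
    \<le> (L2_norm (\<lambda>x. flip a f x - (a / cnj a) / (b / cnj b) * flip b f x))\<^sup>2"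
    by (intro cINF_lower[where f="\<lambda>c. (L2_norm (\<lambda>x. flip a f x - c * flip b f x))\<^sup>2"]
      bdd_belowI2[where m=0]) (simp_all only: mem_Collect_eq zero_le_power2)
  also note flip_distance_le[OF fL F, of a b]
  finally show "let \<beta>a = 2 * Im a / (cmod a)\<^sup>2; \<beta>b = 2 * Im b / (cmod b)\<^sup>2 in
    (INF c\<in>{c. cmod c = 1}. (L2_norm (\<lambda>x. flip a f x - c * flip b f x))\<^sup>2)
      \<le> ?C1 b * modulus_L2 fhat \<bar>\<beta>b - \<beta>a\<bar> * L2_norm f + ?C2 a b * (L2_norm f)\<^sup>2"
    using ab by (simp add: Let_def)
qed

end
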